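(* Let $a_i>0$ and $b_i>0$ for $i\ge1$. For $n\ge1$ and $k\ge0$ denote by $c^{(n)}_k$ the coefficients in the Taylor series expansions $$\beta\Big(\begin{matrix} a_1,\dots,a_n\\ b_1,\dots,b_n\end{matrix}\Big\vert z\Big)=\sum_{k\ge0}c^{(n)}_kz^k,\qquad |z|<1.$$ Then for $n\ge2$ and $k\ge0$, $$c^{(n)}_k=\frac{1}{k+a_1+\dots+a_n}\sum_{l=0}^kc^{(n-1)}_{k-l}\,\frac{(1-b_n)_l}{l!}.$$
   Context: For $n\in\mathbb N$, $a_i>0$, $b_i>0$ ($1\le i\le n$) and $z\in[0,1]$, the generalized incomplete beta function is $$\mathrm B\Big(\begin{matrix} a_1,\dots,a_n\\ b_1,\dots,b_n\end{matrix}\Big\vert z\Big)=\int\mathbf 1_{\{0\le x_1\le x_2\le\dots\le x_n\le z\}}\prod_{i=1}^nx_i^{a_i-1}(1-x_i)^{b_i-1}\,\mathrm dx_1\cdots\mathrm dx_n ,$$ and for $z\in(0,1]$ $$\beta\Big(\begin{matrix} a_1,\dots,a_n\\ b_1,\dots,b_n\end{matrix}\Big\vert z\Big):=z^{-a_1-a_2-\dots-a_n}\,\mathrm B\Big(\begin{matrix} a_1,\dots,a_n\\ b_1,\dots,b_n\end{matrix}\Big\vert z\Big).$$ The function $z\mapsto\beta\Big(\begin{matrix} a_1,\dots,a_n\\ b_1,\dots,b_n\end{matrix}\Big\vert z\Big)$ extends from $(0,1)$ to an analytic function in $\mathbb C\setminus[1,\infty)$, denoted by the same symbol; hence it has a Taylor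 series at $0$ converging for $|z|<1$. $(a)_k=a(a+1)\cdots(a+k-1)$ denotes the Pochhammer symbol, with $(a)_0=1$. *)

theory Defs
  imports "HOL-Complex_Analysis.Complex_Analysis"
begin

text \<open>Parameter sequences are functions on \<^typ>\<open>nat\<close> of which only the values at
  \<open>1, \<dots>, n\<close> matter. Points of \<open>n\<close>-space are functions on \<open>{1..n}\<close>, with the product
  Lebesgue measure. The meaningful range of \<open>z\<close> is \<open>[0, 1]\<close>; there all bases of
  \<^const>\<open>powr\<close> in the domain of integration are nonnegative.\<close>

definition incomplete_Beta :: "nat \<Rightarrow> (nat \<Rightarrow> real) \<Rightarrow> (nat \<Rightarrow> real) \<Rightarrow> real \<Rightarrow> real" where
  "incomplete_Beta n a b z =
     (LINT x | (\<Pi>\<^sub>M i\<in>{1..n}. lborel).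
        indicator {x. 0 \<le> x 1 \<and> (\<forall>i\<in>{1..<n}. x i \<le> x (Suc i)) \<and> x n \<le> z} x *
        (\<Prod>i=1..n. x i powr (a i - 1) * (1 - x i) powr (b i - 1)))"

definition scaled_beta :: "nat \<Rightarrow> (nat \<Rightarrow> real) \<Rightarrow> (nat \<Rightarrow> real) \<Rightarrow> real \<Rightarrow> real" where
  "scaled_beta n a b z = z powr (- (\<Sum>i=1..n. a i)) * incomplete_Beta n a b z"

definition slit_plane :: "complex set" where
  "slit_plane = - (complex_of_real ` {1..})"

definition is_analytic_extension ::
    "nat \<Rightarrow> (nat \<Rightarrow> real) \<Rightarrow> (nat \<Rightarrow> real) \<Rightarrow> (complex \<Rightarrow> complex) \<Rightarrow> bool" where
  "is_analytic_extension n a b f \<longleftrightarrow>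
     f analytic_on slit_plane \<and>
     (\<forall>x\<in>{0<..<1}. f (complex_of_real x) = complex_of_real (scaled_beta n a b x))"

text \<open>The slit plane is connected, so by the identity theorem an analytic extension is unique
  on it; the choice below is free only on the slit \<open>[1, \<infinity>)\<close>.\<close>

definition analytic_beta :: "nat \<Rightarrow> (nat \<Rightarrow> real) \<Rightarrow> (nat \<Rightarrow> real) \<Rightarrow> complex \<Rightarrow> complex" where
  "analytic_beta n a b = (SOME f. is_analytic_extension n a b f)"

definition beta_coeff :: "nat \<Rightarrow> (nat \<Rightarrow> real) \<Rightarrow> (nat \<Rightarrow> real) \<Rightarrow> nat \<Rightarrow> complex" where
  "beta_coeff n a b k = (deriv ^^ k) (analytic_beta n a b) 0 / fact k"

end

theory Submission
  imports Defs
begin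

text \<open>Integrating over the outermost variable last gives
  \<open>B\<^sub>n(z) = \<integral>\<^sub>0\<^sup>z x powr (a\<^sub>n - 1) * (1 - x) powr (b\<^sub>n - 1) * B\<^sub>n\<^sub>-\<^sub>1(x) dx\<close>. With
  \<open>A = a\<^sub>1 + \<dots> + a\<^sub>n\<close> and \<open>B\<^sub>n(z) = z powr A * \<beta>\<^sub>n(z)\<close> this says that \<open>\<beta>\<^sub>n\<close> is the solution, regular
  at \<open>0\<close>, of \<open>z * \<beta>\<^sub>n'(z) + A * \<beta>\<^sub>n(z) = (1 - z) powr (b\<^sub>n - 1) * \<beta>\<^sub>n\<^sub>-\<^sub>1(z)\<close>. The equation has a
  solution holomorphic on the whole slit plane, because the latter is star-shaped about \<open>0\<close>; this yields
  the analytic extension by induction on \<open>n\<close>. Comparing coefficients at \<open>0\<close> gives the recursion.\<close>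

section \<open>Geometry of the slit plane\<close>

text \<open>The principal branch of \<open>w powr c\<close> is holomorphic off the nonpositive
  reals, so this form of membership is what makes \<open>(1 - z) powr c\<close> holomorphic on the
  slit plane.\<close>

lemma slit_plane_iff: "z \<in> slit_plane \<longleftrightarrow> 1 - z \<notin> \<real>\<^sub>\<le>\<^sub>0"
proof -
  have "1 - z \<in> \<real>\<^sub>\<le>\<^sub>0 \<longleftrightarrow> z \<in> complex_of_real ` {1..}"
    by (auto simp: complex_nonpos_Reals_iff image_iff complex_eq_iff intro!: bexI[of _ "Re z"])
  thus ?thesis by (simp add: slit_plane_def)
qed

lemma open_slit_plane: "open slit_plane"
proof -
  have "slit_plane = (\<lambda>z. 1 - z) -` (- \<real>\<^sub>\<le>\<^sub>0)"
    by (auto simp: slit_plane_iff)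
  moreover have "open \<dots>"
    by (intro open_vimage open_Compl closed_nonpos_Reals_complex continuous_intros)
  ultimately show ?thesis
    by simp
qed

text \<open>A point off the real axis stays off it for \<open>t > 0\<close>, and
  \<open>Re z < 1\<close> is preserved by scaling. Star-shapedness about 0 serves twice: for
  integrating along segments from 0 and for connectedness.\<close>

lemma scale_in_slit_plane:
  assumes "z \<in> slit_plane" "0 \<le> t" "t \<le> 1"
  shows "of_real t * z \<in> slit_plane"
proof -
  have "Im z \<noteq> 0 \<or> Re z < 1"
    using assms by (auto simp: slit_plane_iff complex_nonpos_Reals_iff)
  moreover have "t * Re z < 1" if "Re z < 1"
    using that assms mult_left_le_one_le[of "Re z" t] mult_nonneg_nonpos[of t "Re z"] by linarith
  ultimately show ?thesis
    using assms by (cases "t = 0") (auto simp: slit_plane_iff complex_nonpos_Reals_iff)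
qed

lemma zero_in_slit_plane: "0 \<in> slit_plane"
  by (auto simp: slit_plane_iff complex_nonpos_Reals_iff)

lemma of_real_in_slit_plane: "x < 1 \<Longrightarrow> complex_of_real x \<in> slit_plane"
  by (auto simp: slit_plane_iff complex_nonpos_Reals_iff)

lemma connected_slit_plane: "connected slit_plane"
proof (rule starlike_imp_connected)
  have "closed_segment 0 z \<subseteq> slit_plane" if "z \<in> slit_plane" for z
    using scale_in_slit_plane[OF that] by (auto simp: closed_segment_def scaleR_conv_of_real)
  with zero_in_slit_plane show "starlike slit_plane"
    unfolding starlike_def by blast
qed

section \<open>The equation \<open>z * F' + A * F = g\<close> on star-shaped domains\<close>

text \<open>The solution is the integral of \<open>t powr (A - 1) * g (t * z)\<close> over \<open>[0, 1]\<close>; the substitution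
  \<open>s = t powr A\<close> removes the singularity at \<open>t = 0\<close>.\<close>

lemma euler_ode_solution_exists:
  fixes g :: "complex \<Rightarrow> complex"
  assumes S: "open S" "\<And>z t. z \<in> S \<Longrightarrow> 0 \<le> t \<Longrightarrow> t \<le> 1 \<Longrightarrow> of_real t * z \<in> S"
    and g: "g holomorphic_on S" and A: "A > (0::real)"
  shows "\<exists>F. F holomorphic_on S \<and> (\<forall>z\<in>S. z * deriv F z + of_real A * F z = g z)"
proof -
  \<comment> \<open>With \<open>t = s powr p\<close> one has
    \<open>t powr (A - 1) dt = p ds\<close>; below, \<open>q s\<close> is this \<open>t\<close> as a
    complex number.\<close>
  define p where "p = 1 / A"
  have p: "p > 0" and Ap: "A * p = 1" using A by (auto simp: p_def)
  define q :: "real \<Rightarrow> complex" where "q s = of_real (s powr p)" for s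
  have cont_q: "continuous_on {0..1} q"
    unfolding q_def using p by (intro continuous_intros continuous_on_powr') auto
  have qS: "z * q s \<in> S" if "z \<in> S" "s \<in> {0..1}" for z s
    using S(2)[OF that(1), of "s powr p"] that(2) p powr_mono2[of p s 1]
    by (auto simp: q_def mult.commute)
  have g': "deriv g holomorphic_on S"
    using g S(1) by (rule holomorphic_deriv)
  have gD: "(g has_field_derivative deriv g w) (at w)" if "w \<in> S" for w
    using g S(1) that by (rule holomorphic_derivI)
  have cont_g: "continuous_on S g" "continuous_on S (deriv g)"
    using g g' by (auto intro: holomorphic_on_imp_continuous_on)
  define F where "F z = of_real p * integral {0..1} (\<lambda>s. g (z * q s))" for z
  define F' where "F' z = of_real p * integral {0..1} (\<lambda>s. q s * deriv g (z * q s))" for z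
  have cont1: "continuous_on {0..1} (\<lambda>s. g (z * q s))" if "z \<in> S" for z
    by (rule continuous_on_compose2[OF cont_g(1)])
      (use qS that in \<open>auto intro!: continuous_intros cont_q\<close>)
  have cont2: "continuous_on {0..1} (\<lambda>s. q s * deriv g (z * q s))" if "z \<in> S" for z
    by (intro continuous_on_mult cont_q continuous_on_compose2[OF cont_g(2)])
      (use qS that in \<open>auto intro!: continuous_intros cont_q\<close>)
  have FD: "(F has_field_derivative F' z) (at z)" if z: "z \<in> S" for z
  proof -
    obtain e where e: "e > 0" "ball z e \<subseteq> S"
      using S(1) z by (auto simp: open_contains_ball)
    \<comment> \<open>Differentiation under the integral sign is done on a ball, as the Leibniz rule
      asks for a convex neighbourhood.\<close>
    have "((\<lambda>x. integral (cbox 0 1) (\<lambda>s. g (x * q s))) has_field_derivative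
            integral (cbox 0 1) (\<lambda>s. q s * deriv g (z * q s))) (at z within ball z e)"
    proof (rule leibniz_rule_field_derivative)
      fix x s assume x: "x \<in> ball z e" and s: "s \<in> cbox (0::real) 1"
      have *: "x * q s \<in> S" using e x s qS by auto
      show "((\<lambda>x. g (x * q s)) has_field_derivative q s * deriv g (x * q s)) (at x within ball z e)"
        using DERIV_chain2[where f = g and g = "\<lambda>x. x * q s", OF gD[OF *]
            DERIV_cmult_right[OF DERIV_ident]]
        by (auto intro: has_field_derivative_at_within simp: mult.commute)
    next
      fix x assume "x \<in> ball z e"
      with e show "(\<lambda>s. g (x * q s)) integrable_on cbox 0 1"
        using integrable_continuous_real[OF cont1[of x]] by auto
    next
      have "continuous_on (ball z e \<times> {0..1}) (\<lambda>w. q (snd w))"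
        by (rule continuous_on_compose2[OF cont_q]) (auto intro!: continuous_intros)
      moreover from this have "continuous_on (ball z e \<times> {0..1}) (\<lambda>w. deriv g (fst w * q (snd w)))"
        by (intro continuous_on_compose2[OF cont_g(2)] continuous_intros) (use e qS in auto)
      ultimately show "continuous_on (ball z e \<times> cbox 0 1) (\<lambda>(x, s). q s * deriv g (x * q s))"
        by (auto simp: case_prod_unfold intro!: continuous_intros)
    qed (use e in auto)
    hence "((\<lambda>x. integral {0..1} (\<lambda>s. g (x * q s))) has_field_derivative
            integral {0..1} (\<lambda>s. q s * deriv g (z * q s))) (at z)"
      using at_within_open[of z "ball z e"] e by simp
    thus ?thesis
      unfolding F_def F'_def by (intro derivative_eq_intros) auto
  qed
  have "z * F' z + of_real A * F z = g z" if z: "z \<in> S" for z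
  proof -
    let ?h = "\<lambda>s. of_real s * g (z * q s)"
    \<comment> \<open>The integrand is the derivative of \<open>s * g (z * q s)\<close>, because
      \<open>s * q' s = p * q s\<close>. Its boundary values are \<open>g z\<close> and 0, and
      \<open>A * p = 1\<close> turns the identity into the differential equation. Only the interior
      is differentiated, as \<open>s powr p\<close> need not be differentiable at 0.\<close>
    have "((\<lambda>s. g (z * q s) + of_real p * z * (q s * deriv g (z * q s))) has_integral ?h 1 - ?h 0) {0..1}"
    proof (rule fundamental_theorem_of_calculus_interior)
      show "continuous_on {0..1} ?h"
        using cont1[OF z] by (intro continuous_intros) auto
      fix s :: real assume s: "s \<in> {0<..<1}"
      have "((\<lambda>s. s powr p) has_real_derivative p * s powr (p - 1)) (at s)"
        using s by (auto intro!: derivative_eq_intros)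
      hence "(q has_vector_derivative of_real (p * s powr (p - 1))) (at s)"
        unfolding q_def by (intro has_vector_derivative_of_real)
          (auto simp: has_real_derivative_iff_has_vector_derivative)
      hence "((\<lambda>s. z * q s) has_vector_derivative z * of_real (p * s powr (p - 1))) (at s)"
        by (rule has_vector_derivative_mult_right)
      hence "(g \<circ> (\<lambda>s. z * q s) has_vector_derivative
              z * of_real (p * s powr (p - 1)) * deriv g (z * q s)) (at s)"
        by (rule field_vector_diff_chain_at) (use qS z s in \<open>auto intro!: gD\<close>)
      moreover have "((\<lambda>s. of_real s) has_vector_derivative (of_real 1 :: complex)) (at s)"
        by (rule has_vector_derivative_of_real) (rule DERIV_ident)
      ultimately have "((\<lambda>s. of_real s * (g \<circ> (\<lambda>s. z * q s)) s) has_vector_derivative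
              of_real s * (z * of_real (p * s powr (p - 1)) * deriv g (z * q s)) +
              of_real 1 * (g \<circ> (\<lambda>s. z * q s)) s) (at s)"
        by (intro has_vector_derivative_mult)
      moreover have "q s = of_real s * of_real (s powr (p - 1))"
        using s by (simp add: q_def powr_diff)
      ultimately show "(?h has_vector_derivative
          g (z * q s) + of_real p * z * (q s * deriv g (z * q s))) (at s)"
        by (simp add: o_def algebra_simps)
    qed auto
    hence "g z = integral {0..1} (\<lambda>s. g (z * q s) + of_real p * z * (q s * deriv g (z * q s)))"
      by (simp add: q_def integral_unique)
    also have "\<dots> = integral {0..1} (\<lambda>s. g (z * q s)) +
        of_real p * z * integral {0..1} (\<lambda>s. q s * deriv g (z * q s))"
      by (subst integral_add)
        (use cont1[OF z] cont2[OF z] in \<open>auto intro!: integrable_continuous_real continuous_intros\<close>)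
    also have "\<dots> = of_real A * F z + z * F' z"
      using Ap by (simp add: F_def F'_def flip: of_real_mult mult.assoc)
    finally show ?thesis by simp
  qed
  moreover have "deriv F z = F' z" if "z \<in> S" for z
    using FD[OF that] by (rule DERIV_imp_deriv)
  moreover have "F holomorphic_on S"
    using FD S(1) by (auto simp: holomorphic_on_open)
  ultimately show ?thesis
    by (intro exI[of _ F]) simp
qed

text \<open>By the equation, the derivative of \<open>x powr A * F x\<close> is
  \<open>x powr (A - 1) * g x\<close>; the boundary term at 0 vanishes since
  \<open>0 powr A = 0\<close>. This ties any solution holomorphic near 0 to the real integral,
  whichever way it was constructed.\<close>

lemma euler_ode_has_integral:
  fixes F g :: "complex \<Rightarrow> complex" and A z :: real
  assumes "F holomorphic_on S" "open S" "A > 0" "z \<ge> 0" "of_real ` {0..z} \<subseteq> S"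
    and ode: "\<And>w. w \<in> S \<Longrightarrow> w * deriv F w + of_real A * F w = g w"
  shows "((\<lambda>x. of_real (x powr (A - 1)) * g (of_real x)) has_integral
           of_real (z powr A) * F (of_real z)) {0..z}"
proof -
  let ?h = "\<lambda>x. of_real (x powr A) * F (of_real x)"
  have "((\<lambda>x. of_real (x powr (A - 1)) * g (of_real x)) has_integral ?h z - ?h 0) {0..z}"
  proof (rule fundamental_theorem_of_calculus_interior)
    show "continuous_on {0..z} ?h"
      by (intro continuous_intros continuous_on_powr'
          continuous_on_compose2[OF holomorphic_on_imp_continuous_on[OF assms(1)]])
        (use assms in auto)
    fix x :: real assume x: "x \<in> {0<..<z}"
    have xS: "of_real x \<in> S" using x assms by auto
    have "((\<lambda>x. x powr A) has_real_derivative A * x powr (A - 1)) (at x)"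
      using x by (auto intro!: derivative_eq_intros)
    hence "((\<lambda>x. of_real (x powr A)) has_vector_derivative (of_real (A * x powr (A - 1)) :: complex)) (at x)"
      by (intro has_vector_derivative_of_real)
        (auto simp: has_real_derivative_iff_has_vector_derivative)
    moreover have "((F \<circ> of_real) has_vector_derivative 1 * deriv F (of_real x)) (at x)"
      by (rule field_vector_diff_chain_at)
        (use holomorphic_derivI[OF assms(1,2) xS] has_vector_derivative_of_real[OF DERIV_ident] in auto)
    ultimately have "((\<lambda>x. of_real (x powr A) * (F \<circ> of_real) x) has_vector_derivative
        of_real (x powr A) * (1 * deriv F (of_real x)) +
        of_real (A * x powr (A - 1)) * (F \<circ> of_real) x) (at x)"
      by (rule has_vector_derivative_mult)
    moreover have "complex_of_real (x powr A) = of_real (x powr (A - 1)) * of_real x"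
      using x by (simp add: powr_diff)
    ultimately show "(?h has_vector_derivative of_real (x powr (A - 1)) * g (of_real x)) (at x)"
      using ode[OF xS, symmetric] by (simp add: algebra_simps o_def)
  qed (use assms in auto)
  thus ?thesis using assms by simp
qed

section \<open>Taylor coefficients at 0\<close>

text \<open>This is the binomial series at \<open>- z\<close>: the sign in
  \<open>(c gchoose k) = (-1)^k * pochhammer (- c) k / fact k\<close> cancels that of
  \<open>(- z) ^ k\<close>.\<close>

lemma has_fps_expansion_one_minus_powr:
  fixes c :: complex
  shows "(\<lambda>z. (1 - z) powr c) has_fps_expansion Abs_fps (\<lambda>k. pochhammer (- c) k / fact k)"
proof (rule has_fps_expansionI)
  have "(\<lambda>k. pochhammer (- c) k / fact k * z ^ k) sums (1 - z) powr c" if "norm z < 1" for z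
  proof -
    have "(\<lambda>k. (c gchoose k) * (- z) ^ k) sums (1 + - z) powr c"
      by (rule gen_binomial_complex) (use that in auto)
    moreover have "(c gchoose k) * (- z) ^ k = pochhammer (- c) k / fact k * z ^ k" for k
      unfolding gbinomial_pochhammer by (cases "even k") auto
    ultimately show ?thesis
      by simp
  qed
  moreover have "eventually (\<lambda>z::complex. z \<in> ball 0 1) (nhds 0)"
    by (intro eventually_nhds_in_open) auto
  ultimately show "\<forall>\<^sub>F z in nhds 0. (\<lambda>n. fps_nth (Abs_fps (\<lambda>k. pochhammer (- c) k / fact k)) n * z ^ n)
      sums (1 - z) powr c"
    by (auto elim!: eventually_mono)
qed

text \<open>The operator \<open>z * d/dz + A\<close> multiplies the \<open>k\<close>-th coefficient
  by \<open>k + A\<close>, while the right-hand side is a Cauchy product with the binomial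
  series.\<close>

lemma euler_ode_coeff:
  fixes F f :: "complex \<Rightarrow> complex" and c :: complex
  assumes S: "open S" "0 \<in> S" and F: "F holomorphic_on S" and f: "f holomorphic_on S"
    and ode: "\<And>z. z \<in> S \<Longrightarrow> z * deriv F z + A * F z = (1 - z) powr c * f z"
  shows "(of_nat k + A) * ((deriv ^^ k) F 0 / fact k) =
    (\<Sum>l=0..k. (deriv ^^ (k - l)) f 0 / fact (k - l) * (pochhammer (- c) l / fact l))"
proof -
  let ?F = "fps_expansion F 0" and ?f = "fps_expansion f 0"
  let ?P = "Abs_fps (\<lambda>k. pochhammer (- c) k / fact k) * ?f"
  have FE: "F has_fps_expansion ?F" and fE: "f has_fps_expansion ?f"
    using S F f by (auto intro: has_fps_expansion_fps_expansion)
  have L: "(\<lambda>z. z * deriv F z + A * F z) has_fps_expansion fps_X * fps_deriv ?F + fps_const A * ?F"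
    by (intro fps_expansion_intros FE)
  have P: "(\<lambda>z. (1 - z) powr c * f z) has_fps_expansion ?P"
    by (intro has_fps_expansion_mult has_fps_expansion_one_minus_powr fE)
  have "eventually (\<lambda>z. z \<in> S) (nhds 0)"
    using S by (intro eventually_nhds_in_open)
  hence "eventually (\<lambda>z. z * deriv F z + A * F z = (1 - z) powr c * f z) (nhds 0)"
    by eventually_elim (rule ode)
  hence "(\<lambda>z. z * deriv F z + A * F z) has_fps_expansion ?P"
    using P by (subst has_fps_expansion_cong) auto
  with L have "fps_X * fps_deriv ?F + fps_const A * ?F = ?P"
    by (rule fps_expansion_unique_complex)
  hence "fps_nth (fps_X * fps_deriv ?F + fps_const A * ?F) k = fps_nth ?P k"
    by (rule arg_cong)
  moreover have "fps_nth (fps_X * fps_deriv ?F + fps_const A * ?F) k = (of_nat k + A) * fps_nth ?F k"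
    by (cases k) (auto simp: algebra_simps)
  moreover have "fps_nth ?P k = (\<Sum>l=0..k. fps_nth ?f (k - l) * (pochhammer (- c) l / fact l))"
    unfolding fps_mult_nth by (simp add: mult.commute)
  ultimately show ?thesis
    by (simp add: fps_expansion_def)
qed

section \<open>The multiple integral as an iterated nonnegative integral\<close>

text \<open>Nonnegative integrals satisfy Tonelli unconditionally, so that integrability of the integrand
  need not be known in advance; it comes out of the closed form in terms of the analytic extension.\<close>

definition nn_incomplete_Beta :: "nat \<Rightarrow> (nat \<Rightarrow> real) \<Rightarrow> (nat \<Rightarrow> real) \<Rightarrow> real \<Rightarrow> ennreal" where
  "nn_incomplete_Beta n a b z =
     (\<integral>\<^sup>+ x. ennreal (indicator {x. 0 \<le> x 1 \<and> (\<forall>i\<in>{1..<n}. x i \<le> x (Suc i)) \<and> x n \<le> z} x *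
        (\<Prod>i=1..n. x i powr (a i - 1) * (1 - x i) powr (b i - 1))) \<partial>(\<Pi>\<^sub>M i\<in>{1..n}. lborel))"

lemma measurable_Beta_integrand:
  assumes "n \<ge> 1"
  shows "(\<lambda>x. indicator {x. 0 \<le> x 1 \<and> (\<forall>i\<in>{1..<n}. x i \<le> x (Suc i)) \<and> x n \<le> z} x *
        (\<Prod>i=1..n. x i powr (a i - 1) * (1 - x i) powr (b i - 1)) :: real)
      \<in> borel_measurable (\<Pi>\<^sub>M i\<in>{1..n}. lborel)"
proof -
  have comp: "(\<lambda>x. x i) \<in> borel_measurable (\<Pi>\<^sub>M i\<in>{1..n}. (lborel :: real measure))"
    if "i \<in> {1..n}" for i
    using measurable_component_singleton[OF that, of "\<lambda>_. lborel :: real measure"] by simp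
  have le: "Measurable.pred M (\<lambda>x. f x \<le> g x)"
    if "f \<in> borel_measurable M" "g \<in> borel_measurable M"
    for M :: "(nat \<Rightarrow> real) measure" and f g :: "(nat \<Rightarrow> real) \<Rightarrow> real"
    using borel_measurable_le[OF that] by (simp add: pred_def)
  have "Measurable.pred (\<Pi>\<^sub>M i\<in>{1..n}. lborel)
      (\<lambda>x. (0::real) \<le> x 1 \<and> (\<forall>i\<in>{1..<n}. x i \<le> x (Suc i)) \<and> x n \<le> z)"
    using assms by (intro pred_intros_logic pred_intros_finite le
        borel_measurable_const comp) auto
  moreover have "(\<lambda>x. \<Prod>i=1..n. x i powr (a i - 1) * (1 - x i) powr (b i - 1))
      \<in> borel_measurable (\<Pi>\<^sub>M i\<in>{1..n}. (lborel :: real measure))"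
    by (intro borel_measurable_prod borel_measurable_times powr_real_measurable
        borel_measurable_diff borel_measurable_const comp)
  ultimately show ?thesis
    by (intro borel_measurable_times borel_measurable_indicator') auto
qed

text \<open>The integrand is nonnegative and measurable. The identity covers the divergent case too,
  where both sides are 0 by convention.\<close>

lemma incomplete_Beta_conv_nn:
  assumes "n \<ge> 1"
  shows "incomplete_Beta n a b z = enn2real (nn_incomplete_Beta n a b z)"
  unfolding incomplete_Beta_def nn_incomplete_Beta_def
  by (intro integral_eq_nn_integral measurable_Beta_integrand[OF assms])
    (auto intro!: mult_nonneg_nonneg prod_nonneg AE_I2)

lemma nn_incomplete_Beta_1:
  "nn_incomplete_Beta 1 a b z =
     (\<integral>\<^sup>+ y. ennreal (y powr (a 1 - 1) * (1 - y) powr (b 1 - 1)) * indicator {0..z} y \<partial>lborel)"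
proof -
  interpret product_sigma_finite "\<lambda>_::nat. lborel :: real measure" ..
  have "nn_incomplete_Beta 1 a b z = (\<integral>\<^sup>+ x. (\<lambda>y. ennreal (y powr (a 1 - 1) * (1 - y) powr (b 1 - 1)) *
      indicator {0..z} y) (x 1) \<partial>(\<Pi>\<^sub>M i\<in>{1::nat}. lborel))"
    unfolding nn_incomplete_Beta_def atLeastAtMost_singleton
    by (intro nn_integral_cong) (auto simp: indicator_def)
  also have "\<dots> = (\<integral>\<^sup>+ y. ennreal (y powr (a 1 - 1) * (1 - y) powr (b 1 - 1)) *
      indicator {0..z} y \<partial>lborel)"
    by (rule product_nn_integral_singleton) measurable
  finally show ?thesis .
qed

text \<open>Tonelli with the largest variable \<open>y\<close> outermost: for fixed \<open>y\<close>
  the remaining variables form a chain bounded by \<open>y\<close>. The range is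
  \<open>{..z}\<close> and not \<open>{0..z}\<close>, since \<open>0 \<le> y\<close> is enforced
  only by the inner chain.\<close>

lemma nn_incomplete_Beta_Suc:
  assumes "n \<ge> 1"
  shows "nn_incomplete_Beta (Suc n) a b z =
     (\<integral>\<^sup>+ y. ennreal (y powr (a (Suc n) - 1) * (1 - y) powr (b (Suc n) - 1)) *
        nn_incomplete_Beta n a b y * indicator {..z} y \<partial>lborel)"
proof -
  interpret product_sigma_finite "\<lambda>_::nat. lborel :: real measure" ..
  let ?I = "\<lambda>n z x. indicator {x. 0 \<le> x 1 \<and> (\<forall>i\<in>{1..<n}. x i \<le> x (Suc i)) \<and> x n \<le> z} x *
        (\<Prod>i=1..n. x i powr (a i - 1) * (1 - x i) powr (b i - 1)) :: real"
  let ?w = "\<lambda>y. y powr (a (Suc n) - 1) * (1 - y) powr (b (Suc n) - 1)"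
  have ins: "{1..Suc n} = insert (Suc n) {1..n}" by auto
  have upd: "?I (Suc n) z (x(Suc n := y)) = ?w y * ?I n y x * indicator {..z} y" for x y
  proof -
    \<comment> \<open>The additional chain condition, at index \<open>n\<close>, reads
      \<open>x n \<le> y\<close>; it takes the place of the upper bound in the integrand for
      \<open>n\<close>.\<close>
    have "{1..<Suc n} = insert n {1..<n}" using assms by auto
    hence "(\<forall>i\<in>{1..<Suc n}. (x(Suc n := y)) i \<le> (x(Suc n := y)) (Suc i)) \<longleftrightarrow>
        x n \<le> y \<and> (\<forall>i\<in>{1..<n}. x i \<le> x (Suc i))"
      by auto
    moreover have "(\<Prod>i=1..n. (x(Suc n := y)) i powr (a i - 1) * (1 - (x(Suc n := y)) i) powr (b i - 1)) =
        (\<Prod>i=1..n. x i powr (a i - 1) * (1 - x i) powr (b i - 1))"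
      by (intro prod.cong) auto
    ultimately show ?thesis
      using assms by (auto simp: indicator_def prod.nat_ivl_Suc' mult_ac)
  qed
  have "nn_incomplete_Beta (Suc n) a b z =
      (\<integral>\<^sup>+ y. \<integral>\<^sup>+ x. ennreal (?I (Suc n) z (x(Suc n := y))) \<partial>(\<Pi>\<^sub>M i\<in>{1..n}. lborel) \<partial>lborel)"
    unfolding nn_incomplete_Beta_def ins
    by (rule product_nn_integral_insert_rev[OF _ _ measurable_compose[OF
          measurable_Beta_integrand[of "Suc n" z a b, unfolded ins] measurable_ennreal]]) auto
  also have "\<dots> = (\<integral>\<^sup>+ y. \<integral>\<^sup>+ x. ennreal (?w y) * indicator {..z} y * ennreal (?I n y x)
      \<partial>(\<Pi>\<^sub>M i\<in>{1..n}. lborel) \<partial>lborel)"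
    unfolding upd by (intro nn_integral_cong)
      (auto simp: ennreal_mult' prod_nonneg mult_ac split: split_indicator)
  also have "\<dots> = (\<integral>\<^sup>+ y. ennreal (?w y) * indicator {..z} y * nn_incomplete_Beta n a b y \<partial>lborel)"
    unfolding nn_incomplete_Beta_def
    by (intro nn_integral_cong nn_integral_cmult)
      (use measurable_Beta_integrand[OF assms] in auto)
  finally show ?thesis by (simp add: mult_ac)
qed

section \<open>Holomorphic representation by induction\<close>

text \<open>The solution of the equation with right-hand side
  \<open>(1 - z) powr (d - 1) * f z\<close> satisfies
  \<open>z powr (s + c) * F z = \<integral> h\<close> over \<open>{0..z}\<close> with a real
  nonnegative \<open>h\<close>; hence \<open>F\<close> is real and nonnegative on (0, 1). The
  exponent \<open>s\<close> stands for the sum of the earlier parameters, and \<open>s = 0\<close>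
  is allowed for the base case.\<close>

lemma weighted_Beta_step:
  fixes f :: "complex \<Rightarrow> complex" and r :: "real \<Rightarrow> real"
  assumes f: "f holomorphic_on slit_plane"
    and r: "\<And>x. x \<in> {0<..<1} \<Longrightarrow> f (of_real x) = of_real (r x) \<and> r x \<ge> 0"
    and pos: "c > 0" "s \<ge> 0"
  shows "\<exists>F R. F holomorphic_on slit_plane \<and>
    (\<forall>z\<in>slit_plane. z * deriv F z + of_real (s + c) * F z = (1 - z) powr of_real (d - 1) * f z) \<and>
    (\<forall>z\<in>{0<..<1}. F (of_real z) = of_real (R z) \<and> R z \<ge> 0 \<and>
      (\<integral>\<^sup>+ y. ennreal (y powr (c - 1) * (1 - y) powr (d - 1)) * ennreal (y powr s * r y) *
         indicator {0..z} y \<partial>lborel) = ennreal (z powr (s + c) * R z))"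
proof -
  let ?g = "\<lambda>z. (1 - z) powr of_real (d - 1) * f z"
  have "?g holomorphic_on slit_plane"
    using f by (intro holomorphic_intros) (auto simp: slit_plane_iff)
  then obtain F where F: "F holomorphic_on slit_plane"
    and ode: "\<And>z. z \<in> slit_plane \<Longrightarrow> z * deriv F z + of_real (s + c) * F z = ?g z"
    using euler_ode_solution_exists[OF open_slit_plane scale_in_slit_plane, of ?g "s + c"] pos by auto
  have real: "F (of_real z) = of_real (Re (F (of_real z))) \<and> Re (F (of_real z)) \<ge> 0 \<and>
      (\<integral>\<^sup>+ y. ennreal (y powr (c - 1) * (1 - y) powr (d - 1)) * ennreal (y powr s * r y) *
         indicator {0..z} y \<partial>lborel) = ennreal (z powr (s + c) * Re (F (of_real z)))"
    if z: "z \<in> {0<..<1}" for z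
  proof -
    define h where "h y = y powr (c - 1) * (1 - y) powr (d - 1) * (y powr s * r y)" for y
    \<comment> \<open>The point 0 is left out because \<open>r\<close> is controlled only on the
      open interval; a single point does not affect the integral.\<close>
    have h_eq: "of_real (y powr (s + c - 1)) * ?g (of_real y) = of_real (h y)" if "y \<in> {0..z} - {0}" for y
    proof -
      have "(1 - complex_of_real y) powr of_real (d - 1) = of_real ((1 - y) powr (d - 1))"
        using that z powr_of_real[of "1 - y" "d - 1"] by simp
      moreover have "y powr (s + c - 1) = y powr (c - 1) * y powr s"
        by (simp add: algebra_simps flip: powr_add)
      ultimately show ?thesis
        using r[of y] that z by (simp add: h_def)
    qed
    have "((\<lambda>y. of_real (y powr (s + c - 1)) * ?g (of_real y)) has_integral
        of_real (z powr (s + c)) * F (of_real z)) {0..z}"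
      using pos z by (intro euler_ode_has_integral[OF F open_slit_plane _ _ _ ode])
        (auto intro!: of_real_in_slit_plane)
    hence int: "((\<lambda>y. complex_of_real (h y)) has_integral of_real (z powr (s + c)) * F (of_real z)) {0..z}"
      by (rule has_integral_spike_finite[where S = "{0}", rotated 2]) (use h_eq[symmetric] in simp_all)
    have int_Re: "(h has_integral z powr (s + c) * Re (F (of_real z))) {0..z}"
      using has_integral_linear[OF int bounded_linear_Re] by (simp add: o_def)
    \<comment> \<open>The integrand is real, so the imaginary part of the integral is 0, and the
      factor \<open>z powr (s + c)\<close> is nonzero.\<close>
    have "((\<lambda>y. 0) has_integral z powr (s + c) * Im (F (of_real z))) {0..z}"
      using has_integral_linear[OF int bounded_linear_Im] by (simp add: o_def)
    hence Im0: "Im (F (of_real z)) = 0"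
      using has_integral_unique[OF has_integral_0] z by fastforce
    have h_nonneg: "h y \<ge> 0" if "y \<in> {0..z}" for y
      using r[of y] that z by (cases "y = 0") (auto simp: h_def)
    have "z powr (s + c) * Re (F (of_real z)) \<ge> 0"
      using int_Re h_nonneg by (rule has_integral_nonneg)
    hence "Re (F (of_real z)) \<ge> 0"
      using z by (auto simp: zero_le_mult_iff)
    \<comment> \<open>Finiteness of the nonnegative integral is obtained here, from the closed
      form.\<close>
    moreover have "(\<integral>\<^sup>+ y. ennreal (h y) * indicator {0..z} y \<partial>lborel) =
        ennreal (z powr (s + c) * Re (F (of_real z)))"
      using h_nonneg int_Re by (rule nn_integral_has_integral_lebesgue')
    moreover have "ennreal (h y) =
        ennreal (y powr (c - 1) * (1 - y) powr (d - 1)) * ennreal (y powr s * r y)" for y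
      by (simp add: h_def ennreal_mult')
    ultimately show ?thesis
      using Im0 by (simp add: complex_eq_iff)
  qed
  show ?thesis
    by (rule exI[of _ F], rule exI[of _ "\<lambda>z. Re (F (of_real z))"]) (use F ode real in blast)
qed

text \<open>The induction invariant: \<open>f\<close> is a candidate for the analytic extension and
  \<open>r\<close> its real values on (0, 1). Vanishing for \<open>z \<le> 0\<close> is included
  because the recursion integrates over all \<open>y \<le> z\<close>, negative \<open>y\<close>
  among them.\<close>

definition represents_Beta ::
    "nat \<Rightarrow> (nat \<Rightarrow> real) \<Rightarrow> (nat \<Rightarrow> real) \<Rightarrow> (complex \<Rightarrow> complex) \<Rightarrow> (real \<Rightarrow> real) \<Rightarrow> bool" where
  "represents_Beta n a b f r \<longleftrightarrow>
     f holomorphic_on slit_plane \<and> (\<forall>z\<le>0. nn_incomplete_Beta n a b z = 0) \<and>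
     (\<forall>z\<in>{0<..<1}. f (of_real z) = of_real (r z) \<and> r z \<ge> 0 \<and>
        nn_incomplete_Beta n a b z = ennreal (z powr (\<Sum>i=1..n. a i) * r z))"

text \<open>The case \<open>s = 0\<close> and \<open>f = r = 1\<close> of
  \<open>weighted_Beta_step\<close>.\<close>

lemma represents_Beta_1:
  assumes "a 1 > 0"
  shows "\<exists>f r. represents_Beta 1 a b f r"
proof -
  have "\<exists>F R. F holomorphic_on slit_plane \<and>
    (\<forall>z\<in>slit_plane. z * deriv F z + of_real (0 + a 1) * F z = (1 - z) powr of_real (b 1 - 1) * 1) \<and>
    (\<forall>z\<in>{0<..<1}. F (of_real z) = of_real (R z) \<and> R z \<ge> 0 \<and>
      (\<integral>\<^sup>+ y. ennreal (y powr (a 1 - 1) * (1 - y) powr (b 1 - 1)) * ennreal (y powr 0 * 1) *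
         indicator {0..z} y \<partial>lborel) = ennreal (z powr (0 + a 1) * R z))"
    using assms by (intro weighted_Beta_step) auto
  then obtain F R where F: "F holomorphic_on slit_plane" and
    R: "\<forall>z\<in>{0<..<1}. F (of_real z) = of_real (R z) \<and> R z \<ge> 0 \<and>
      (\<integral>\<^sup>+ y. ennreal (y powr (a 1 - 1) * (1 - y) powr (b 1 - 1)) * ennreal (y powr 0 * 1) *
         indicator {0..z} y \<partial>lborel) = ennreal (z powr (0 + a 1) * R z)"
    by (elim exE conjE)
  have "nn_incomplete_Beta 1 a b z = 0" if "z \<le> 0" for z
  proof -
    \<comment> \<open>At most \<open>y = 0\<close> lies in \<open>{0..z}\<close>, and there
      \<open>0 powr (a 1 - 1) = 0\<close>.\<close>
    have "AE y in lborel. ennreal (y powr (a 1 - 1) * (1 - y) powr (b 1 - 1)) * indicator {0..z} y = 0"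
      using that by (auto simp: indicator_def)
    thus ?thesis
      unfolding nn_incomplete_Beta_1 by (subst nn_integral_cong_AE[where v = "\<lambda>_. 0"]) auto
  qed
  moreover have "nn_incomplete_Beta 1 a b z = ennreal (z powr a 1 * R z)" if "z \<in> {0<..<1}" for z
  proof -
    \<comment> \<open>The factor \<open>y powr 0\<close> is 1 for \<open>y > 0\<close>; at
      \<open>y = 0\<close> it is 0, but so is \<open>y powr (a 1 - 1)\<close>.\<close>
    have "nn_incomplete_Beta 1 a b z =
      (\<integral>\<^sup>+ y. ennreal (y powr (a 1 - 1) * (1 - y) powr (b 1 - 1)) * ennreal (y powr 0 * 1) *
         indicator {0..z} y \<partial>lborel)"
      unfolding nn_incomplete_Beta_1 by (intro nn_integral_cong) (auto simp: indicator_def)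
    thus ?thesis using R[rule_format, OF that] by simp
  qed
  ultimately have "represents_Beta 1 a b F R"
    using F R by (simp add: represents_Beta_def)
  thus ?thesis by blast
qed

text \<open>The differential equation is kept in the conclusion because the coefficient recursion is
  read off from it.\<close>

lemma represents_Beta_Suc:
  assumes f: "represents_Beta n a b f r" and n: "n \<ge> 1" and a: "\<And>i. i \<ge> 1 \<Longrightarrow> a i > 0"
  shows "\<exists>F R. represents_Beta (Suc n) a b F R \<and>
    (\<forall>z\<in>slit_plane. z * deriv F z + of_real (\<Sum>i=1..Suc n. a i) * F z =
       (1 - z) powr of_real (b (Suc n) - 1) * f z)"
proof -
  let ?s = "\<Sum>i=1..n. a i"
  have s: "(\<Sum>i=1..Suc n. a i) = ?s + a (Suc n)" by simp
  have "f holomorphic_on slit_plane" "\<And>x. x \<in> {0<..<1} \<Longrightarrow> f (of_real x) = of_real (r x) \<and> r x \<ge> 0"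
    using f by (auto simp: represents_Beta_def)
  moreover have "a (Suc n) > 0" using a by simp
  moreover have "?s \<ge> 0" by (rule sum_nonneg) (rule less_imp_le, rule a, simp)
  ultimately have "\<exists>F R. F holomorphic_on slit_plane \<and>
    (\<forall>z\<in>slit_plane. z * deriv F z + of_real (?s + a (Suc n)) * F z =
        (1 - z) powr of_real (b (Suc n) - 1) * f z) \<and>
    (\<forall>z\<in>{0<..<1}. F (of_real z) = of_real (R z) \<and> R z \<ge> 0 \<and>
      (\<integral>\<^sup>+ y. ennreal (y powr (a (Suc n) - 1) * (1 - y) powr (b (Suc n) - 1)) *
         ennreal (y powr ?s * r y) * indicator {0..z} y \<partial>lborel) =
      ennreal (z powr (?s + a (Suc n)) * R z))"
    by (rule weighted_Beta_step)
  then obtain F R where F: "F holomorphic_on slit_plane" and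
    ode: "\<forall>z\<in>slit_plane. z * deriv F z + of_real (?s + a (Suc n)) * F z =
        (1 - z) powr of_real (b (Suc n) - 1) * f z" and
    R: "\<forall>z\<in>{0<..<1}. F (of_real z) = of_real (R z) \<and> R z \<ge> 0 \<and>
      (\<integral>\<^sup>+ y. ennreal (y powr (a (Suc n) - 1) * (1 - y) powr (b (Suc n) - 1)) *
         ennreal (y powr ?s * r y) * indicator {0..z} y \<partial>lborel) =
      ennreal (z powr (?s + a (Suc n)) * R z)"
    by (elim exE conjE)
  have "nn_incomplete_Beta (Suc n) a b z = 0" if "z \<le> 0" for z
  proof -
    have *: "ennreal (y powr (a (Suc n) - 1) * (1 - y) powr (b (Suc n) - 1)) *
        nn_incomplete_Beta n a b y * indicator {..z} y = 0" for y
      using f that by (auto simp: represents_Beta_def indicator_def)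
    show ?thesis unfolding nn_incomplete_Beta_Suc[OF n] * by simp
  qed
  moreover have "nn_incomplete_Beta (Suc n) a b z = ennreal (z powr (?s + a (Suc n)) * R z)"
    if "z \<in> {0<..<1}" for z
  proof -
    have "ennreal (y powr (a (Suc n) - 1) * (1 - y) powr (b (Suc n) - 1)) *
        nn_incomplete_Beta n a b y * indicator {..z} y =
      ennreal (y powr (a (Suc n) - 1) * (1 - y) powr (b (Suc n) - 1)) *
         ennreal (y powr ?s * r y) * indicator {0..z} y" for y
    \<comment> \<open>For \<open>y \<le> 0\<close> both sides vanish: the left by the invariant, the
      right by the indicator or, at 0, by \<open>0 powr x = 0\<close>. This passes from
      \<open>{..z}\<close> to \<open>{0..z}\<close>.\<close>
    proof (cases "y \<le> 0")
      case True
      with f show ?thesis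
        by (cases "y = 0") (auto simp: represents_Beta_def)
    next
      case False
      with f that show ?thesis
        by (cases "y \<le> z") (auto simp: represents_Beta_def)
    qed
    thus ?thesis using R[rule_format, OF that] by (simp add: nn_incomplete_Beta_Suc[OF n])
  qed
  ultimately have "represents_Beta (Suc n) a b F R"
    using F R unfolding represents_Beta_def s by simp
  thus ?thesis using ode unfolding s by (intro exI conjI)
qed

lemma represents_Beta_exists:
  assumes "n \<ge> 1" "\<And>i. i \<ge> 1 \<Longrightarrow> a i > 0"
  shows "\<exists>f r. represents_Beta n a b f r"
  using assms(1)
proof (induction n rule: dec_induct)
  case base
  show ?case using represents_Beta_1 assms(2) by auto
next
  case (step n)
  then obtain f r where "represents_Beta n a b f r" by blast
  from represents_Beta_Suc[where b = b, OF this step(1)] assms(2) show ?case by blast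
qed

section \<open>Identification with the chosen extension, and the recursion\<close>

text \<open>The representing function shows that an analytic extension exists, so the choice
  operator returns one; both functions agree on (0, 1), hence on the connected slit plane by the
  identity theorem.\<close>

lemma represents_Beta_eq_analytic_beta:
  assumes f: "represents_Beta n a b f r" and n: "n \<ge> 1" and z: "z \<in> slit_plane"
  shows "analytic_beta n a b z = f z"
proof -
  have scaled: "scaled_beta n a b x = r x" if "x \<in> {0<..<1}" for x
    using f that by (simp add: represents_Beta_def scaled_beta_def incomplete_Beta_conv_nn[OF n] powr_minus)
  have "is_analytic_extension n a b f"
    using f scaled by (auto simp: is_analytic_extension_def represents_Beta_def
        analytic_on_open open_slit_plane)
  hence ext: "is_analytic_extension n a b (analytic_beta n a b)"
    unfolding analytic_beta_def by (rule someI[of "is_analytic_extension n a b"])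
  have sub: "of_real ` {0<..<1} \<subseteq> slit_plane"
    by (auto intro!: of_real_in_slit_plane)
  have holo: "(\<lambda>z. analytic_beta n a b z - f z) holomorphic_on slit_plane"
    using ext f by (intro holomorphic_intros)
      (auto simp: is_analytic_extension_def represents_Beta_def analytic_on_open open_slit_plane)
  \<comment> \<open>The point 1/2 is an arbitrary accumulation point of (0, 1), carried over by the
    continuous injective embedding of the reals.\<close>
  have lim: "complex_of_real (1/2) islimpt complex_of_real ` {0<..<1}"
  proof (rule islimpt_isCont_image)
    show "(1/2::real) islimpt {0<..<1}"
      by (intro interior_limit_point) (simp add: interior_open)
    show "\<forall>\<^sub>F y in at (1/2). complex_of_real y \<noteq> of_real (1/2)"
      unfolding of_real_eq_iff by (rule eventually_neq_at_within)
  qed simp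
  have "complex_of_real (1/2) \<in> slit_plane"
    by (rule of_real_in_slit_plane) simp
  moreover have "analytic_beta n a b w - f w = 0" if "w \<in> of_real ` {0<..<1}" for w
    using ext f scaled that by (auto simp: is_analytic_extension_def represents_Beta_def)
  ultimately have "analytic_beta n a b z - f z = 0"
    using analytic_continuation[OF holo open_slit_plane connected_slit_plane sub _ lim _ z] by blast
  thus ?thesis by simp
qed

lemma represents_Beta_coeff:
  assumes "represents_Beta n a b f r" "n \<ge> 1"
  shows "beta_coeff n a b k = (deriv ^^ k) f 0 / fact k"
proof -
  have "eventually (\<lambda>z. z \<in> slit_plane) (nhds 0)"
    by (intro eventually_nhds_in_open open_slit_plane zero_in_slit_plane)
  hence "eventually (\<lambda>z. analytic_beta n a b z = f z) (nhds 0)"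
    by eventually_elim (rule represents_Beta_eq_analytic_beta[OF assms])
  thus ?thesis
    unfolding beta_coeff_def by (simp add: higher_deriv_cong_ev)
qed

theorem proposition3:
  fixes a b :: "nat \<Rightarrow> real" and n k :: nat
  assumes "\<And>i. i \<ge> 1 \<Longrightarrow> a i > 0"
    and "\<And>i. i \<ge> 1 \<Longrightarrow> b i > 0"
    and "n \<ge> 2"
  shows "beta_coeff n a b k =
    1 / complex_of_real (real k + (\<Sum>i=1..n. a i)) *
    (\<Sum>l=0..k. beta_coeff (n - 1) a b (k - l) *
      complex_of_real (pochhammer (1 - b n) l / fact l))"
proof -
  obtain m where m: "n = Suc m" "m \<ge> 1"
    using assms(3) by (cases n) auto
  let ?A = "\<Sum>i=1..n. a i"
  obtain f r where f: "represents_Beta m a b f r"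
    using represents_Beta_exists[of m a b] m assms(1) by blast
  \<comment> \<open>\<open>F\<close> is built from this very \<open>f\<close>, so one equation links
    the coefficients for \<open>n\<close> to those for \<open>n - 1\<close>.\<close>
  have "\<exists>F R. represents_Beta n a b F R \<and>
    (\<forall>z\<in>slit_plane. z * deriv F z + of_real ?A * F z = (1 - z) powr of_real (b n - 1) * f z)"
    unfolding m(1) using f m(2) assms(1) by (rule represents_Beta_Suc)
  then obtain F R where F: "represents_Beta n a b F R" and
    ode: "\<forall>z\<in>slit_plane. z * deriv F z + of_real ?A * F z = (1 - z) powr of_real (b n - 1) * f z"
    by (elim exE conjE)
  have "(of_nat k + of_real ?A) * ((deriv ^^ k) F 0 / fact k) =
    (\<Sum>l=0..k. (deriv ^^ (k - l)) f 0 / fact (k - l) * (pochhammer (- of_real (b n - 1)) l / fact l))"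
    by (rule euler_ode_coeff[OF open_slit_plane zero_in_slit_plane _ _ ode[rule_format]])
      (use F f in \<open>auto simp: represents_Beta_def\<close>)
  moreover have "pochhammer (- of_real (b n - 1)) l / fact l =
      complex_of_real (pochhammer (1 - b n) l / fact l)" for l
    by (simp flip: pochhammer_of_real)
  ultimately have "complex_of_real (real k + ?A) * beta_coeff n a b k =
    (\<Sum>l=0..k. beta_coeff (n - 1) a b (k - l) * complex_of_real (pochhammer (1 - b n) l / fact l))"
    using represents_Beta_coeff[OF F] represents_Beta_coeff[OF f m(2)] m by simp
  moreover have "?A > 0"
    using assms m by (intro sum_pos) auto
  hence "complex_of_real (real k + ?A) \<noteq> 0"
    unfolding of_real_eq_0_iff by linarith
  ultimately show ?thesis
    by (metis mult_1 nonzero_mult_div_cancel_left times_divide_eq_left)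
qed

end
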